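(* Let $\mathcal{I}$ be a lattice in $F=\mathbb{Q}(\sqrt D)\oplus\mathbb{Q}$. Let $Q$ be the function $$Q:\ F\to\mathbb{Q}^3,\qquad (x,q)\mapsto\begin{pmatrix}\mathcal{N}(\sqrt D\,x)\\ \mathrm{tr}(x)\,q\\ \mathrm{tr}(\sqrt D\,x)\,q\end{pmatrix}$$ and let $\langle\cdot,\cdot\rangle_s$ be the standard scalar product on $\mathbb{Q}^3$. Then an $\mathcal{I}$-weighted boundary stratum $\mathcal{S}$ is admissible if and only if for every $v\in\mathbb{Q}^3$ the following holds: if $\langle v,Q(w)\rangle_s\ge0$ for all $w\in\mathrm{Weight}(\mathcal{S})$, then $\langle v,Q(w)\rangle_s=0$ for all $w\in\mathrm{Weight}(\mathcal{S})$. Equivalently, an $\mathcal{I}$-weighted boundary stratum $\mathcal{S}$ is admissible if and only if the set $Q(\mathcal{S}):=\{Q(w):w\in\mathrm{Weight}(\mathcal{S})\}$ is not contained in a closed half-space of its $\mathbb{Q}$-span, and this holds if and only if $0$ lies in the interior (relative to the $\mathbb{Q}$-span of $Q(\mathcal{S})$) of the convex hull of $Q(\mathcal{S})$.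
   Context: $D>0$ is a non-square discriminant (integer $\equiv0,1\bmod4$), $K=\mathbb{Q}(\sqrt D)$ with Galois conjugation $\sigma$, $\mathcal{N}(x)=xx^\sigma$, $\mathrm{tr}(x)=x+x^\sigma$; $F=K\oplus\mathbb{Q}$ as a $\mathbb{Q}$-algebra; $\mathrm{tr}_p(x,q)=\mathrm{tr}(x)+q$. A lattice in $F$ is a free Abelian subgroup of rank three. Each node of a stable curve gives two opposite cusps $c,c'$ (points of the normalization). An $\mathcal{I}$-weighting of a stable curve of arithmetic genus three and geometric genus zero is a map $w$ from its cusps to $\mathcal{I}$ with $w(c)=-w(c')$, weights on every irreducible component summing to $0$, and image generating $\mathcal{I}$. An $\mathcal{I}$-weighted boundary stratum $\mathcal{S}$ is an equivalence class of such weighted curves under weight-preserving homeomorphism; $\mathrm{Weight}(\mathcal{S})\subset\mathcal{I}$ is its (finite) set of weights. Let $\mathrm{Sym}_{\mathbb{Q}}(F)\subset F\otimes_{\mathbb{Q}}F$ be the symmetric tensors and $\mathbf{S}_{\mathbb{Q}}(F)$ the quotient of $F\otimes_{\mathbb{Q}}F$ by the swap of factors, with the perfect pairing $\mathbf{S}_{\mathbb{Q}}(F)\times\mathrm{Sym}_{\mathbb{Q}}(F)\to\mathbb{Q}$, $\langle[\varphi_1\otimes\varphi_2],\sum q_{ij}x_i\otimes x_j\rangle=\sum q_{ij}\mathrm{tr}_p(\varphi_1x_i)\mathrm{tr}_p(\varphi_2x_j)$. Put $\Lambda_1=\{\lambda\in F\otimes_{\mathbb{Q}}F:x\lambda=\lambda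 x\ \forall x\in F\}\subset\mathrm{Sym}_{\mathbb{Q}}(F)$ (where $F\otimes_{\mathbb{Q}} F$ is an $F$-bimodule), let $\mathrm{Ann}(\Lambda_1)\subset\mathbf{S}_{\mathbb{Q}}(F)$ be its annihilator, and let $\mathcal{C}(\mathcal{S})$ (resp. $\mathcal{N}(\mathcal{S})$) be the set of $a\in\mathbf{S}_{\mathbb{Q}}(F)$ with $\langle a,w\otimes w\rangle\ge0$ (resp. $=0$) for all $w\in\mathrm{Weight}(\mathcal{S})$. $\mathcal{S}$ is called admissible if $\mathcal{C}(\mathcal{S})\cap\mathrm{Ann}(\Lambda_1)\subset\mathcal{N}(\mathcal{S})$. A closed half-space of a $\mathbb{Q}$-vector space $V$ is a set $\{x\in V:\ell(x)\geq0\}$ with $\ell$ a non-zero linear form on $V$. *)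

theory Defs
  imports
    "HOL-Analysis.Analysis"
    "HOL-Library.Poly_Mapping"
begin

section \<open>The algebra \<open>F = \<rat>(\<surd>D) \<oplus> \<rat>\<close>\<close>

text \<open>
  The pair \<open>(a, b)\<close> stands for \<open>a + b \<surd>D\<close>. The underlying \<open>\<rat>\<close>-vector spaces of \<open>K = \<rat>(\<surd>D)\<close>
  and \<open>F\<close> do not depend on \<open>D\<close>, only the multiplications do. The additive structure is the
  componentwise one of the library. The lemmas on \<open>K_real\<close> below identify \<open>K\<close> with the
  subfield \<open>\<rat>(\<surd>D)\<close> of the real numbers.
\<close>

type_synonym K = "rat \<times> rat"
type_synonym F = "K \<times> rat"

definition K_mult :: "int \<Rightarrow> K \<Rightarrow> K \<Rightarrow> K" where
  "K_mult D x y =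
     (fst x * fst y + of_int D * (snd x * snd y), fst x * snd y + snd x * fst y)"

definition K_sqrt :: K where
  "K_sqrt = (0, 1)"

definition K_conj :: "K \<Rightarrow> K" where
  "K_conj x = (fst x, - snd x)"

text \<open>Norm and trace are the rational numbers that \<open>x x\<^sup>\<sigma>\<close> and \<open>x + x\<^sup>\<sigma>\<close> are equal to.\<close>

definition K_norm :: "int \<Rightarrow> K \<Rightarrow> rat" where
  "K_norm D x = fst (K_mult D x (K_conj x))"

definition K_trace :: "K \<Rightarrow> rat" where
  "K_trace x = fst (x + K_conj x)"

lemma K_mult_conj: "K_mult D x (K_conj x) = (K_norm D x, 0)"
  by (simp add: K_norm_def K_mult_def K_conj_def)

lemma K_add_conj: "x + K_conj x = (K_trace x, 0)"
  by (cases x) (simp add: K_trace_def K_conj_def)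

definition K_real :: "int \<Rightarrow> K \<Rightarrow> real" where
  "K_real D x = of_rat (fst x) + of_rat (snd x) * sqrt (of_int D)"

lemma K_real_add: "K_real D (x + y) = K_real D x + K_real D y"
  by (simp add: K_real_def of_rat_add algebra_simps)

lemma K_real_mult:
  assumes "D \<ge> 0"
  shows "K_real D (K_mult D x y) = K_real D x * K_real D y"
proof -
  have "sqrt (of_int D) * sqrt (of_int D) = of_int D"
    using assms by simp
  then show ?thesis
    by (simp add: K_real_def K_mult_def of_rat_add of_rat_mult distrib_left distrib_right)
qed

lemma K_real_one: "K_real D (1, 0) = 1"
  by (simp add: K_real_def)

lemma K_real_sqrt: "K_real D K_sqrt = sqrt (of_int D)"
  by (simp add: K_real_def K_sqrt_def)

lemma K_real_inj:
  assumes "D > 0" and "\<nexists>n. D = n\<^sup>2"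
  shows "inj (K_real D)"
proof (rule injI)
  fix x y :: K
  assume eq: "K_real D x = K_real D y"
  define a where "a = fst x - fst y"
  define b where "b = snd x - snd y"
  have z: "of_rat a + of_rat b * sqrt (of_int D) = 0"
    using eq by (simp add: K_real_def a_def b_def of_rat_diff algebra_simps)
  have "b = 0"
  proof (rule ccontr)
    assume b: "b \<noteq> 0"
    then have "sqrt (of_int D) = of_rat (- a / b)"
      using z by (simp add: of_rat_divide of_rat_minus field_simps)
    then have "(of_rat (- a / b) :: real)\<^sup>2 = of_int D"
      using assms by (metis real_sqrt_pow2 of_int_0_le_iff less_imp_le)
    then have "(of_rat ((- a / b)\<^sup>2) :: real) = of_rat (of_int D)"
      by (simp only: of_rat_power of_rat_of_int_eq)
    then have sq: "(- a / b)\<^sup>2 = of_int D"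
      using of_rat_eq_iff by blast
    obtain p q where pq: "quotient_of (- a / b) = (p, q)"
      by fastforce
    have q: "q > 0" and cop: "coprime p q" and r: "- a / b = of_int p / of_int q"
      using quotient_of_denom_pos[OF pq] quotient_of_coprime[OF pq] quotient_of_div[OF pq]
      by auto
    have "(of_int p :: rat)\<^sup>2 = of_int D * (of_int q)\<^sup>2"
      using sq q unfolding r by (simp add: power_divide field_simps)
    then have "(of_int (p\<^sup>2) :: rat) = of_int (D * q\<^sup>2)"
      by simp
    then have p: "p\<^sup>2 = D * q\<^sup>2"
      using of_int_eq_iff by blast
    then have "q\<^sup>2 dvd p\<^sup>2"
      by simp
    then have "q dvd p"
      by simp
    then have "q = 1"
      using cop q by (metis abs_of_pos coprime_absorb_right zdvd1_eq)
    then show False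
      using p assms(2) by auto
  qed
  moreover from this have "a = 0"
    using z by simp
  ultimately show "x = y"
    by (simp add: a_def b_def prod_eq_iff)
qed

definition F_mult :: "int \<Rightarrow> F \<Rightarrow> F \<Rightarrow> F" where
  "F_mult D x y = (K_mult D (fst x) (fst y), snd x * snd y)"

definition F_scale :: "rat \<Rightarrow> F \<Rightarrow> F" where
  "F_scale c x = ((c * fst (fst x), c * snd (fst x)), c * snd x)"

definition tr\<^sub>p :: "F \<Rightarrow> rat" where
  "tr\<^sub>p x = K_trace (fst x) + snd x"

lemma tr\<^sub>p_0 [simp]: "tr\<^sub>p 0 = 0"
  by (simp add: tr\<^sub>p_def K_trace_def K_conj_def)

lemma tr\<^sub>p_add: "tr\<^sub>p (x + y) = tr\<^sub>p x + tr\<^sub>p y"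
  by (simp add: tr\<^sub>p_def K_trace_def K_conj_def)

lemma F_mult_add_left: "F_mult D (x + y) z = F_mult D x z + F_mult D y z"
  by (simp add: F_mult_def K_mult_def prod_eq_iff algebra_simps)

lemma F_mult_add_right: "F_mult D x (y + z) = F_mult D x y + F_mult D x z"
  by (simp add: F_mult_def K_mult_def prod_eq_iff algebra_simps)

lemma F_mult_scale_left: "F_mult D (F_scale c x) y = F_scale c (F_mult D x y)"
  by (simp add: F_mult_def K_mult_def F_scale_def prod_eq_iff algebra_simps)

lemma F_mult_scale_right: "F_mult D x (F_scale c y) = F_scale c (F_mult D x y)"
  by (simp add: F_mult_def K_mult_def F_scale_def prod_eq_iff algebra_simps)

lemma F_mult_commute: "F_mult D x y = F_mult D y x"
  by (simp add: F_mult_def K_mult_def prod_eq_iff algebra_simps)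

lemma tr\<^sub>p_scale: "tr\<^sub>p (F_scale c x) = c * tr\<^sub>p x"
  by (simp add: tr\<^sub>p_def K_trace_def K_conj_def F_scale_def algebra_simps)

interpretation F_int: module "\<lambda>(n::int) (x::F). F_scale (of_int n) x"
  by unfold_locales (simp_all add: F_scale_def prod_eq_iff algebra_simps)

definition is_lattice :: "F set \<Rightarrow> bool" where
  "is_lattice I \<longleftrightarrow> (\<exists>B. card B = 3 \<and> F_int.independent B \<and> I = F_int.span B)"


section \<open>Weighted stable curves and boundary strata\<close>

text \<open>
  A stable curve of geometric genus zero is given by its normalization, a disjoint union of
  copies of the Riemann sphere (the one-point compactification of the complex plane) indexed by
  the irreducible components, together with the pairs of points of the normalization that are
  glued to the nodes. The elements of such a pair are the two opposite cusps of the node.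
\<close>

type_synonym point = "nat \<times> complex option"

record weighted_curve =
  components :: "nat set"
  nodes :: "point set set"
  weight :: "point \<Rightarrow> F"

definition normalization :: "'a weighted_curve_scheme \<Rightarrow> point topology" where
  "normalization X =
     prod_topology (discrete_topology (components X)) (Alexandroff_compactification euclidean)"

definition cusps :: "'a weighted_curve_scheme \<Rightarrow> point set" where
  "cusps X = \<Union> (nodes X)"

definition nodal_curve :: "'a weighted_curve_scheme \<Rightarrow> bool" where
  "nodal_curve X \<longleftrightarrow>
     finite (components X) \<and> components X \<noteq> {} \<and>
     finite (nodes X) \<and> disjoint (nodes X) \<and>
     (\<forall>n\<in>nodes X. card n = 2 \<and> n \<subseteq> topspace (normalization X))"

definition connected_curve :: "'a weighted_curve_scheme \<Rightarrow> bool" where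
  "connected_curve X \<longleftrightarrow>
     (\<forall>i\<in>components X. \<forall>j\<in>components X.
        (i, j) \<in> {(k, l). \<exists>n\<in>nodes X. \<exists>c\<in>n. \<exists>c'\<in>n. fst c = k \<and> fst c' = l}\<^sup>*)"

text \<open>
  For a connected nodal curve with components of geometric genus \<open>g\<^sub>i\<close> the arithmetic genus is
  \<open>\<Sum>g\<^sub>i + #nodes - #components + 1\<close>; here all \<open>g\<^sub>i\<close> are zero.
\<close>

definition arithmetic_genus :: "'a weighted_curve_scheme \<Rightarrow> int" where
  "arithmetic_genus X = int (card (nodes X)) - int (card (components X)) + 1"

definition stable_curve :: "'a weighted_curve_scheme \<Rightarrow> bool" where
  "stable_curve X \<longleftrightarrow>
     nodal_curve X \<and> connected_curve X \<and>
     (\<forall>i\<in>components X. 3 \<le> card {c \<in> cusps X. fst c = i})"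

text \<open>
  The function \<open>weight X\<close> is required to be \<open>undefined\<close> outside the cusps, so that it carries
  exactly the information of a map on the cusps.
\<close>

definition weighted_stable_curve :: "F set \<Rightarrow> weighted_curve \<Rightarrow> bool" where
  "weighted_stable_curve I X \<longleftrightarrow>
     stable_curve X \<and> arithmetic_genus X = 3 \<and>
     weight X \<in> cusps X \<rightarrow>\<^sub>E I \<and>
     (\<forall>n\<in>nodes X. \<forall>c\<in>n. \<forall>c'\<in>n. c \<noteq> c' \<longrightarrow> weight X c = - weight X c') \<and>
     (\<forall>i\<in>components X. (\<Sum>c | c \<in> cusps X \<and> fst c = i. weight X c) = 0) \<and>
     F_int.span (weight X ` cusps X) = I"

text \<open>
  Homeomorphisms of nodal curves are the homeomorphisms of their normalizations that respect the
  gluing. Only on the normalization does preserving the weights of the cusps make sense.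
\<close>

definition weighted_homeomorphic :: "weighted_curve \<Rightarrow> weighted_curve \<Rightarrow> bool" where
  "weighted_homeomorphic X Y \<longleftrightarrow>
     (\<exists>f. homeomorphic_map (normalization X) (normalization Y) f \<and>
          (`) f ` nodes X = nodes Y \<and>
          (\<forall>c\<in>cusps X. weight Y (f c) = weight X c))"

definition boundary_strata :: "F set \<Rightarrow> weighted_curve set set" where
  "boundary_strata I =
     {X. weighted_stable_curve I X} //
     {(X, Y). weighted_stable_curve I X \<and> weighted_stable_curve I Y \<and> weighted_homeomorphic X Y}"

definition Weight :: "weighted_curve set \<Rightarrow> F set" where
  "Weight S = (\<Union>X\<in>S. weight X ` cusps X)"


section \<open>The tensor square of \<open>F\<close>\<close>

text \<open>
  \<open>F \<otimes>\<^sub>\<rat> F\<close> is the quotient of the free Abelian group on \<open>F \<times> F\<close> by the subgroup generated by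
  the biadditivity and \<open>\<rat>\<close>-balancedness relations. Rational scalars act on either factor.
\<close>

inductive_set tensor_relations :: "(F \<times> F \<Rightarrow>\<^sub>0 int) set" where
  zero: "0 \<in> tensor_relations"
| diff: "s \<in> tensor_relations \<Longrightarrow> t \<in> tensor_relations \<Longrightarrow> s - t \<in> tensor_relations"
| add_left: "frag_of (x + y, z) - (frag_of (x, z) + frag_of (y, z)) \<in> tensor_relations"
| add_right: "frag_of (x, y + z) - (frag_of (x, y) + frag_of (x, z)) \<in> tensor_relations"
| balanced: "frag_of (F_scale c x, y) - frag_of (x, F_scale c y) \<in> tensor_relations"

lemma tensor_relations_minus: "s \<in> tensor_relations \<Longrightarrow> - s \<in> tensor_relations"
  using tensor_relations.diff[OF tensor_relations.zero] by fastforce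

lemma tensor_relations_add:
  "s \<in> tensor_relations \<Longrightarrow> t \<in> tensor_relations \<Longrightarrow> s + t \<in> tensor_relations"
  using tensor_relations.diff[OF _ tensor_relations_minus] by fastforce

quotient_type tensor = "F \<times> F \<Rightarrow>\<^sub>0 int" / "\<lambda>s t. s - t \<in> tensor_relations"
proof (rule equivpI)
  show "reflp (\<lambda>s t. s - t \<in> tensor_relations)"
    by (simp add: reflp_def tensor_relations.zero)
  show "symp (\<lambda>s t. s - t \<in> tensor_relations)"
    by (metis (mono_tags, lifting) minus_diff_eq sympI tensor_relations_minus)
  show "transp (\<lambda>s t. s - t \<in> tensor_relations)"
    by (metis (mono_tags, lifting) diff_add_cancel add_diff_eq tensor_relations_add transpI)
qed

instantiation tensor :: ab_group_add
begin

lift_definition zero_tensor :: tensor is 0 .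

lift_definition plus_tensor :: "tensor \<Rightarrow> tensor \<Rightarrow> tensor" is "(+)"
  by (metis add_diff_add tensor_relations_add)

lift_definition uminus_tensor :: "tensor \<Rightarrow> tensor" is uminus
  by (metis minus_diff_minus tensor_relations_minus)

lift_definition minus_tensor :: "tensor \<Rightarrow> tensor \<Rightarrow> tensor" is "(-)"
proof -
  fix a b c d :: "F \<times> F \<Rightarrow>\<^sub>0 int"
  assume "a - b \<in> tensor_relations" "c - d \<in> tensor_relations"
  then have "(a - b) - (c - d) \<in> tensor_relations"
    by (rule tensor_relations.diff)
  then show "a - c - (b - d) \<in> tensor_relations"
    by (simp add: algebra_simps)
qed

instance
  by standard (transfer; simp add: algebra_simps tensor_relations.zero)+

end

lift_definition tens :: "F \<Rightarrow> F \<Rightarrow> tensor" (infix "\<otimes>\<^sub>F" 70) is "\<lambda>x y. frag_of (x, y)" .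

lemma frag_extend_tensor_relations:
  assumes "s \<in> tensor_relations"
    and "\<And>x y z. f (x + y, z) - (f (x, z) + f (y, z)) \<in> tensor_relations"
    and "\<And>x y z. f (x, y + z) - (f (x, y) + f (x, z)) \<in> tensor_relations"
    and "\<And>c x y. f (F_scale c x, y) - f (x, F_scale c y) \<in> tensor_relations"
  shows "frag_extend f s \<in> tensor_relations"
  using assms(1)
  by induction
     (simp_all add: frag_extend_diff frag_extend_add assms(2-4) tensor_relations.zero
        tensor_relations.diff)

text \<open>\<open>swap_tensor\<close> maps \<open>x \<otimes> y\<close> to \<open>y \<otimes> x\<close>.\<close>

lift_definition swap_tensor :: "tensor \<Rightarrow> tensor" is
  "frag_extend (\<lambda>(x, y). frag_of (y, x))"
  unfolding frag_extend_diff[symmetric]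
  by (rule frag_extend_tensor_relations)
     (auto simp: tensor_relations.add_left tensor_relations.add_right
        intro: tensor_relations_minus[OF tensor_relations.balanced, simplified])

text \<open>The bimodule structure: \<open>x (y \<otimes> z) = x y \<otimes> z\<close> and \<open>(y \<otimes> z) x = y \<otimes> z x\<close>.\<close>

lift_definition left_mult :: "int \<Rightarrow> F \<Rightarrow> tensor \<Rightarrow> tensor" is
  "\<lambda>D x. frag_extend (\<lambda>(y, z). frag_of (F_mult D x y, z))"
  unfolding frag_extend_diff[symmetric]
  by (rule frag_extend_tensor_relations)
     (auto simp: F_mult_add_right F_mult_scale_right
        intro: tensor_relations.intros)

lift_definition right_mult :: "int \<Rightarrow> tensor \<Rightarrow> F \<Rightarrow> tensor" is
  "\<lambda>D t x. frag_extend (\<lambda>(y, z). frag_of (y, F_mult D z x)) t"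
  unfolding frag_extend_diff[symmetric]
  by (rule frag_extend_tensor_relations)
     (auto simp: F_mult_add_left F_mult_scale_left
        intro: tensor_relations.intros)

lemma swap_tensor_tens [simp]: "swap_tensor (x \<otimes>\<^sub>F y) = y \<otimes>\<^sub>F x"
  by transfer (simp add: tensor_relations.zero)

lemma left_mult_tens [simp]: "left_mult D x (y \<otimes>\<^sub>F z) = F_mult D x y \<otimes>\<^sub>F z"
  by transfer (simp add: tensor_relations.zero)

lemma right_mult_tens [simp]: "right_mult D (y \<otimes>\<^sub>F z) x = y \<otimes>\<^sub>F F_mult D z x"
  by transfer (simp add: tensor_relations.zero)

lemma swap_tensor_diff: "swap_tensor (s - t) = swap_tensor s - swap_tensor t"
  by transfer (simp add: frag_extend_diff tensor_relations.zero)

lemma swap_tensor_0 [simp]: "swap_tensor 0 = 0"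
  by transfer (simp add: tensor_relations.zero)

definition \<Lambda>\<^sub>1 :: "int \<Rightarrow> tensor set" where
  "\<Lambda>\<^sub>1 D = {t. \<forall>x. left_mult D x t = right_mult D t x}"


section \<open>Symmetric tensors, the symmetric square and their pairing\<close>

typedef sym_tensor = "{t. swap_tensor t = t}"
  morphisms tensor_of_sym sym_of_tensor
  by (rule exI[of _ 0]) simp

setup_lifting type_definition_sym_tensor

lift_definition square_tensor :: "F \<Rightarrow> sym_tensor" is "\<lambda>x. x \<otimes>\<^sub>F x"
  by simp

quotient_type sym_quotient = tensor / "\<lambda>s t. \<exists>u. s - t = u - swap_tensor u"
proof (rule equivpI)
  show "reflp (\<lambda>s t. \<exists>u. s - t = u - swap_tensor u)"
    by (auto simp: reflp_def intro!: exI[of _ 0])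
  show "symp (\<lambda>s t. \<exists>u. s - t = u - swap_tensor u)"
  proof (rule sympI)
    fix s t :: tensor
    assume "\<exists>u. s - t = u - swap_tensor u"
    then obtain u where u: "s - t = u - swap_tensor u" ..
    have "swap_tensor (0 - u) = - swap_tensor u"
      by (simp only: swap_tensor_diff) simp
    then have "t - s = (0 - u) - swap_tensor (0 - u)"
      using u by (simp add: algebra_simps)
    then show "\<exists>u. t - s = u - swap_tensor u" ..
  qed
  show "transp (\<lambda>s t. \<exists>u. s - t = u - swap_tensor u)"
  proof (rule transpI)
    fix r s t :: tensor
    assume "\<exists>u. r - s = u - swap_tensor u" "\<exists>u. s - t = u - swap_tensor u"
    then obtain u v where u: "r - s = u - swap_tensor u" and v: "s - t = v - swap_tensor v"
      by blast
    have "swap_tensor (u - (0 - v)) = swap_tensor u + swap_tensor v"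
      by (simp only: swap_tensor_diff) simp
    moreover have "r - t = (r - s) + (s - t)"
      by simp
    ultimately have "r - t = (u - (0 - v)) - swap_tensor (u - (0 - v))"
      unfolding u v by (simp only: diff_0 diff_minus_eq_add add_diff_add)
    then show "\<exists>u. r - t = u - swap_tensor u" ..
  qed
qed

text \<open>
  \<open>tensor_pairing\<close> is the bilinear form on \<open>F \<otimes> F\<close> with
  \<open>(\<phi>\<^sub>1 \<otimes> \<phi>\<^sub>2, x\<^sub>1 \<otimes> x\<^sub>2) \<mapsto> tr\<^sub>p (\<phi>\<^sub>1 x\<^sub>1) tr\<^sub>p (\<phi>\<^sub>2 x\<^sub>2)\<close>; it descends to the symmetric square in the first
  argument if the second one is restricted to symmetric tensors.
\<close>

definition frag_sum :: "('a \<Rightarrow> rat) \<Rightarrow> ('a \<Rightarrow>\<^sub>0 int) \<Rightarrow> rat" where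
  "frag_sum f s = (\<Sum>p\<in>Poly_Mapping.keys s. of_int (Poly_Mapping.lookup s p) * f p)"

lemma frag_sum_superset:
  assumes "finite A" "Poly_Mapping.keys s \<subseteq> A"
  shows "frag_sum f s = (\<Sum>p\<in>A. of_int (Poly_Mapping.lookup s p) * f p)"
  unfolding frag_sum_def using assms
  by (intro sum.mono_neutral_left) (auto simp: in_keys_iff)

lemma frag_sum_0 [simp]: "frag_sum f 0 = 0"
  by (simp add: frag_sum_def)

lemma frag_sum_of [simp]: "frag_sum f (frag_of p) = f p"
  by (simp add: frag_sum_def)

lemma frag_sum_add: "frag_sum f (s + t) = frag_sum f s + frag_sum f t"
proof -
  let ?A = "Poly_Mapping.keys s \<union> Poly_Mapping.keys t"
  have fin: "finite ?A" by simp
  show ?thesis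
    using Poly_Mapping.keys_add[of s t]
    by (simp add: frag_sum_superset[OF fin] lookup_add sum.distrib algebra_simps)
qed

lemma frag_sum_diff: "frag_sum f (s - t) = frag_sum f s - frag_sum f t"
  using frag_sum_add[of f "s - t" t] by simp

lemma frag_sum_fun_add: "frag_sum (\<lambda>p. f p + g p) s = frag_sum f s + frag_sum g s"
  by (simp add: frag_sum_def sum.distrib algebra_simps)

lemma frag_sum_swap:
  "frag_sum (\<lambda>p. frag_sum (\<lambda>q. f p q) t) s = frag_sum (\<lambda>q. frag_sum (\<lambda>p. f p q) s) t"
  unfolding frag_sum_def sum_distrib_left
  by (subst sum.swap) (simp add: mult.left_commute)

lemma frag_sum_tensor_relations:
  assumes "s \<in> tensor_relations"
    and "\<And>x y z. f (x + y, z) = f (x, z) + f (y, z)"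
    and "\<And>x y z. f (x, y + z) = f (x, y) + f (x, z)"
    and "\<And>c x y. f (F_scale c x, y) = f (x, F_scale c y)"
  shows "frag_sum f s = 0"
  using assms(1)
  by induction (simp_all add: frag_sum_diff frag_sum_add assms(2-4))

lemma frag_sum_extend: "frag_sum f (frag_extend (\<lambda>p. frag_of (g p)) s) = frag_sum (f \<circ> g) s"
  by (rule frag_induction[of s UNIV]) (simp_all add: frag_extend_diff frag_sum_diff)

definition trace_product :: "int \<Rightarrow> F \<times> F \<Rightarrow> F \<times> F \<Rightarrow> rat" where
  "trace_product D p q = tr\<^sub>p (F_mult D (fst p) (fst q)) * tr\<^sub>p (F_mult D (snd p) (snd q))"

lemmas trace_product_simps =
  trace_product_def F_mult_add_left F_mult_add_right F_mult_scale_left F_mult_scale_right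
  tr\<^sub>p_add tr\<^sub>p_scale

lemma trace_product_commute: "trace_product D p q = trace_product D q p"
  by (simp add: trace_product_def F_mult_commute)

lift_definition tensor_pairing :: "int \<Rightarrow> tensor \<Rightarrow> tensor \<Rightarrow> rat" is
  "\<lambda>D s t. frag_sum (\<lambda>p. frag_sum (\<lambda>q. trace_product D p q) t) s"
proof -
  fix D :: int and s s' t t' :: "F \<times> F \<Rightarrow>\<^sub>0 int"
  assume s: "s - s' \<in> tensor_relations" and t: "t - t' \<in> tensor_relations"
  have vanish: "frag_sum (trace_product D p) r = 0" if "r \<in> tensor_relations" for p r
    using that by (rule frag_sum_tensor_relations) (simp_all add: trace_product_simps algebra_simps)
  have left: "frag_sum (\<lambda>p. frag_sum (trace_product D p) r) s
      = frag_sum (\<lambda>p. frag_sum (trace_product D p) r) s'" for r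
  proof -
    have "frag_sum (\<lambda>q. frag_sum (\<lambda>p. trace_product D p q) (s - s')) r = 0"
      using vanish[OF s] by (simp add: trace_product_commute[of D _ q for q] frag_sum_def)
    then have "frag_sum (\<lambda>p. frag_sum (trace_product D p) r) (s - s') = 0"
      by (subst frag_sum_swap)
    then show ?thesis by (simp add: frag_sum_diff)
  qed
  have right: "frag_sum (trace_product D p) t = frag_sum (trace_product D p) t'" for p
    using vanish[OF t, of p] by (simp add: frag_sum_diff)
  show "frag_sum (\<lambda>p. frag_sum (trace_product D p) t) s
      = frag_sum (\<lambda>p. frag_sum (trace_product D p) t') s'"
    by (simp only: left right)
qed

lemma tensor_pairing_tens:
  "tensor_pairing D (y \<otimes>\<^sub>F z) (x \<otimes>\<^sub>F w) = tr\<^sub>p (F_mult D y x) * tr\<^sub>p (F_mult D z w)"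
  by transfer (simp add: trace_product_def)

lemma tensor_pairing_diff_left:
  "tensor_pairing D (r - s) t = tensor_pairing D r t - tensor_pairing D s t"
  by transfer (simp add: frag_sum_diff)

lemma tensor_pairing_swap: "tensor_pairing D (swap_tensor s) (swap_tensor t) = tensor_pairing D s t"
  by transfer
     (simp add: split_def frag_sum_extend o_def trace_product_def[abs_def] mult.commute)

lift_definition pairing :: "int \<Rightarrow> sym_quotient \<Rightarrow> sym_tensor \<Rightarrow> rat" is
  tensor_pairing
proof -
  fix D :: int and s s' t :: tensor
  assume "\<exists>u. s - s' = u - swap_tensor u" and sym: "swap_tensor t = t"
  then obtain u where "s - s' = u - swap_tensor u"
    by blast
  then have "tensor_pairing D (s - s') t = tensor_pairing D (u - swap_tensor u) t"
    by simp
  also have "\<dots> = 0"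
    using tensor_pairing_swap[of D u t] by (simp add: tensor_pairing_diff_left sym)
  finally show "tensor_pairing D s t = tensor_pairing D s' t"
    by (simp add: tensor_pairing_diff_left)
qed

text \<open>
  \<open>Ann\<close> is meant for sets \<open>L\<close> of symmetric tensors, such as \<open>\<Lambda>\<^sub>1\<close>, because the pairing is defined
  on these only.
\<close>

definition Ann :: "int \<Rightarrow> tensor set \<Rightarrow> sym_quotient set" where
  "Ann D L = {a. \<forall>t. tensor_of_sym t \<in> L \<longrightarrow> pairing D a t = 0}"

definition cone :: "int \<Rightarrow> weighted_curve set \<Rightarrow> sym_quotient set" where
  "cone D S = {a. \<forall>w\<in>Weight S. 0 \<le> pairing D a (square_tensor w)}"

definition null_space :: "int \<Rightarrow> weighted_curve set \<Rightarrow> sym_quotient set" where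
  "null_space D S = {a. \<forall>w\<in>Weight S. pairing D a (square_tensor w) = 0}"

definition admissible :: "int \<Rightarrow> weighted_curve set \<Rightarrow> bool" where
  "admissible D S \<longleftrightarrow> cone D S \<inter> Ann D (\<Lambda>\<^sub>1 D) \<subseteq> null_space D S"


section \<open>Half-spaces and convex hulls over \<open>\<rat>\<close>\<close>

definition Q :: "int \<Rightarrow> F \<Rightarrow> rat ^ 3" where
  "Q D = (\<lambda>(x, q). vector
     [K_norm D (K_mult D K_sqrt x), K_trace x * q, K_trace (K_mult D K_sqrt x) * q])"

definition linear_form_on :: "(rat ^ 'n) set \<Rightarrow> (rat ^ 'n \<Rightarrow> rat) \<Rightarrow> bool" where
  "linear_form_on V l \<longleftrightarrow>
     (\<forall>x\<in>V. \<forall>y\<in>V. l (x + y) = l x + l y) \<and> (\<forall>c. \<forall>x\<in>V. l (c *s x) = c * l x)"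

definition closed_half_space :: "(rat ^ 'n) set \<Rightarrow> (rat ^ 'n) set \<Rightarrow> bool" where
  "closed_half_space V H \<longleftrightarrow>
     (\<exists>l. linear_form_on V l \<and> (\<exists>x\<in>V. l x \<noteq> 0) \<and> H = {x \<in> V. 0 \<le> l x})"

definition rat_convex_hull :: "(rat ^ 'n) set \<Rightarrow> (rat ^ 'n) set" where
  "rat_convex_hull A =
     {\<Sum>a\<in>t. u a *s a | t u. finite t \<and> t \<subseteq> A \<and> (\<forall>a\<in>t. 0 \<le> u a) \<and> sum u t = 1}"

text \<open>The topology of \<open>\<rat>\<^sup>n\<close> as a subspace of \<open>\<real>\<^sup>n\<close>.\<close>

definition rat_topology :: "(rat ^ 'n) topology" where
  "rat_topology = pullback_topology UNIV (\<lambda>v. (\<chi> i. of_rat (v $ i)) :: real ^ 'n) euclidean"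

end

theory Submission
  imports Defs
begin

text \<open>
  An element \<open>a\<close> of the symmetric square is a quadratic form \<open>w \<mapsto> \<langle>a, w \<otimes> w\<rangle>\<close> on \<open>F\<close>. The annihilator of
  \<open>\<Lambda>\<^sub>1\<close> consists exactly of the elements whose quadratic form is a linear combination
  \<open>w \<mapsto> \<langle>v, Q(w)\<rangle>\<close> of the entries of \<open>Q\<close>. On the one hand, \<open>\<Lambda>\<^sub>1\<close> contains the Casimir
  tensors of the trace form, and vanishing on them forces this shape
  (\<open>pairing_Ann_\<Lambda>\<^sub>1_eq_scalar_product\<close>). On the other hand, pairing \<open>x \<otimes> y\<close> with a tensor in \<open>\<Lambda>\<^sub>1\<close>
  only depends on the product \<open>x y\<close>, so every such combination comes from an element
  \<open>\<Sum> x\<^sub>i \<otimes> y\<^sub>i\<close> with \<open>\<Sum> x\<^sub>i y\<^sub>i = 0\<close>, which annihilates \<open>\<Lambda>\<^sub>1\<close>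
  (\<open>Ann_\<Lambda>\<^sub>1_realizes_scalar_product\<close>). Therefore admissibility says that every \<open>v\<close> that is
  non-negative on \<open>Q(S)\<close> vanishes on \<open>Q(S)\<close>.

  The rest is convex geometry of the set \<open>Q(S)\<close>, which is finite and non-empty. Some \<open>v\<close>
  violates this condition if and only if a closed half-space of the span contains \<open>Q(S)\<close>, because
  linear forms on the span extend to the whole space
  (\<open>subset_closed_half_space_iff_one_sided\<close>). If there is none, then Farkas' lemma
  over \<open>\<rat>\<close> (\<open>farkas\<close>) shows that the cone over \<open>Q(S)\<close> is its whole span, and by finiteness the small
  vectors of the span are convex combinations of \<open>Q(S)\<close>
  (\<open>zero_interior_rat_convex_hull_iff\<close>).
\<close>


section \<open>Tensors, multiplications and the trace pairing\<close>

lemma tens_add_left: "(x + y) \<otimes>\<^sub>F z = x \<otimes>\<^sub>F z + y \<otimes>\<^sub>F z"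
  by transfer (rule tensor_relations.add_left)

lemma tens_add_right: "x \<otimes>\<^sub>F (y + z) = x \<otimes>\<^sub>F y + x \<otimes>\<^sub>F z"
  by transfer (rule tensor_relations.add_right)

lemma tens_balanced: "F_scale c x \<otimes>\<^sub>F y = x \<otimes>\<^sub>F F_scale c y"
  by transfer (rule tensor_relations.balanced)

lemma swap_tensor_add: "swap_tensor (s + t) = swap_tensor s + swap_tensor t"
  by transfer (simp add: frag_extend_add tensor_relations.zero)

lemma left_mult_add: "left_mult D x (s + t) = left_mult D x s + left_mult D x t"
  by transfer (simp add: frag_extend_add tensor_relations.zero)

lemma right_mult_add: "right_mult D (s + t) x = right_mult D s x + right_mult D t x"
  by transfer (simp add: frag_extend_add tensor_relations.zero)

lemma tensor_pairing_add_left: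
  "tensor_pairing D (r + s) t = tensor_pairing D r t + tensor_pairing D s t"
  by transfer (simp add: frag_sum_add)

lemma tensor_pairing_add_right:
  "tensor_pairing D t (r + s) = tensor_pairing D t r + tensor_pairing D t s"
  by transfer (simp add: frag_sum_add frag_sum_fun_add)

lemma frag_sum_scale: "frag_sum (\<lambda>p. c * f p) s = c * frag_sum f s"
  by (simp add: frag_sum_def sum_distrib_left mult.left_commute)

lemma tensor_pairing_scale_right:
  "tensor_pairing D s (x \<otimes>\<^sub>F F_scale c y) = c * tensor_pairing D s (x \<otimes>\<^sub>F y)"
  by transfer
    (simp add: trace_product_def F_mult_scale_right tr\<^sub>p_scale mult.left_commute frag_sum_scale)

lemma tr\<^sub>p_mult_adjoint: "tr\<^sub>p (F_mult D y (F_mult D x z)) = tr\<^sub>p (F_mult D (F_mult D x y) z)"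
  by (simp add: F_mult_def K_mult_def tr\<^sub>p_def K_trace_def K_conj_def algebra_simps)

lemma tensor_pairing_left_mult:
  "tensor_pairing D s (left_mult D x t) = tensor_pairing D (left_mult D x s) t"
  by transfer
    (simp add: split_def frag_sum_extend o_def trace_product_def[abs_def] tr\<^sub>p_mult_adjoint)

lemma tr\<^sub>p_mult_adjoint': "tr\<^sub>p (F_mult D y (F_mult D z x)) = tr\<^sub>p (F_mult D (F_mult D y x) z)"
  by (simp add: F_mult_def K_mult_def tr\<^sub>p_def K_trace_def K_conj_def algebra_simps)

lemma tensor_pairing_right_mult:
  "tensor_pairing D s (right_mult D t x) = tensor_pairing D (right_mult D s x) t"
  by transfer
    (simp add: split_def frag_sum_extend o_def trace_product_def[abs_def] tr\<^sub>p_mult_adjoint')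

lemma pairing_abs: "pairing D (abs_sym_quotient s) t = tensor_pairing D s (tensor_of_sym t)"
  by (metis pairing.abs_eq tensor_of_sym_inverse tensor_of_sym eq_onp_same_args mem_Collect_eq)


section \<open>The annihilator of \<open>\<Lambda>\<^sub>1\<close>\<close>

text \<open>
  The basis \<open>1\<close>, \<open>\<surd>D\<close> of the first summand of \<open>F\<close> and the idempotent of the second one. The unit of the
  algebra \<open>F\<close> is not \<open>F_one\<close> but \<open>F_one + F_idem\<close>.
\<close>

definition F_one :: F where "F_one = ((1, 0), 0)"
definition F_sqrt :: F where "F_sqrt = (K_sqrt, 0)"
definition F_idem :: F where "F_idem = (0, 1)"

lemmas F_basis_defs = F_one_def F_sqrt_def F_idem_def K_sqrt_def

lemma F_basis_expansion:
  "((x, y), q) = F_scale x F_one + (F_scale y F_sqrt + F_scale q F_idem)"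
  by (simp add: F_basis_defs F_scale_def)

lemma F_mult_basis:
  "F_mult D ((x, y), q) F_one = F_scale x F_one + F_scale y F_sqrt"
  "F_mult D ((x, y), q) F_sqrt = F_scale (of_int D * y) F_one + F_scale x F_sqrt"
  "F_mult D ((x, y), q) F_idem = F_scale q F_idem"
  by (simp_all add: F_basis_defs F_scale_def F_mult_def K_mult_def)

lemma F_scale_add: "F_scale c (x + y) = F_scale c x + F_scale c y"
  by (simp add: F_scale_def algebra_simps)

lemma F_scale_scale: "F_scale c (F_scale d x) = F_scale (c * d) x"
  by (simp add: F_scale_def)

text \<open>
  If \<open>e\<^sub>i\<close> and \<open>e\<^sub>i\<^sup>*\<close> are dual bases for the trace form, then the Casimir tensor \<open>\<Sum> e\<^sub>i \<otimes> e\<^sub>i\<^sup>*\<close>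
  commutes with the two multiplications. The dual of \<open>(1, \<surd>D)\<close> in \<open>\<rat>(\<surd>D)\<close> is
  \<open>(1 / 2, \<surd>D / (2 D))\<close>. So the first tensor is \<open>2 D\<close> times the Casimir tensor of \<open>\<rat>(\<surd>D)\<close>,
  the second one is \<open>2 \<surd>D\<close> times it, and the third one is the Casimir tensor of the summand \<open>\<rat>\<close>.
\<close>

lemma casimir_in_\<Lambda>\<^sub>1:
  "F_one \<otimes>\<^sub>F F_scale (of_int D) F_one + F_sqrt \<otimes>\<^sub>F F_sqrt \<in> \<Lambda>\<^sub>1 D"
  "F_one \<otimes>\<^sub>F F_sqrt + F_sqrt \<otimes>\<^sub>F F_one \<in> \<Lambda>\<^sub>1 D"
  "F_idem \<otimes>\<^sub>F F_idem \<in> \<Lambda>\<^sub>1 D"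
  unfolding \<Lambda>\<^sub>1_def
  by (auto simp: left_mult_add right_mult_add F_mult_basis F_mult_scale_left F_mult_scale_right
      F_mult_commute[of D _ "((x, y), q)" for x y q] tens_add_left tens_add_right tens_balanced
      F_scale_add F_scale_scale mult_ac add_ac)

lemma scalar_product_Q:
  "scalar_product v (Q D ((x, y), q)) =
     v $ 1 * ((of_int D)\<^sup>2 * y\<^sup>2 - of_int D * x\<^sup>2) + v $ 2 * (2 * x * q) + v $ 3 * (2 * of_int D * y * q)"
  by (simp add: scalar_product_def sum_3 Q_def K_norm_def K_mult_def K_sqrt_def K_conj_def
      K_trace_def power2_eq_square)

text \<open>
  An element of the annihilator satisfies the three linear equations that come from the Casimir
  tensors. A quadratic form on \<open>F\<close> has six coefficients in the coordinates \<open>x\<close>, \<open>y\<close>, \<open>q\<close> of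
  \<open>(x + y \<surd>D, q)\<close>, and the three equations remove the coefficient of \<open>x y\<close>, that of \<open>q\<^sup>2\<close>, and tie the one of \<open>y\<^sup>2\<close> to the one
  of \<open>x\<^sup>2\<close>. What is left is spanned by \<open>x\<^sup>2 - D y\<^sup>2\<close>, \<open>x q\<close> and \<open>y q\<close>, which are the entries of \<open>Q\<close>
  at \<open>(x + y \<surd>D, q)\<close> up to non-zero factors.
\<close>

lemma pairing_Ann_\<Lambda>\<^sub>1_eq_scalar_product:
  assumes "D \<noteq> 0" and a: "a \<in> Ann D (\<Lambda>\<^sub>1 D)"
  shows "\<exists>v. \<forall>w. pairing D a (square_tensor w) = scalar_product v (Q D w)"
proof -
  obtain s where s: "a = abs_sym_quotient s"
    using Quotient3_abs_rep[OF Quotient3_sym_quotient, of a] by metis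
  define b where "b x y = tensor_pairing D s (x \<otimes>\<^sub>F y)" for x y
  have b_add: "b (x + y) z = b x z + b y z" "b x (y + z) = b x y + b x z" for x y z
    by (simp_all add: b_def tens_add_left tens_add_right tensor_pairing_add_right)
  have b_scale: "b (F_scale c x) y = c * b x y" "b x (F_scale c y) = c * b x y" for c x y
    by (simp_all add: b_def tens_balanced tensor_pairing_scale_right)
  have ann: "tensor_pairing D s t = 0" if "swap_tensor t = t" "t \<in> \<Lambda>\<^sub>1 D" for t
    using a that pairing_abs[of D s "sym_of_tensor t"]
    by (simp add: s Ann_def sym_of_tensor_inverse)
  have "swap_tensor (F_one \<otimes>\<^sub>F F_scale (of_int D) F_one + F_sqrt \<otimes>\<^sub>F F_sqrt)
      = F_one \<otimes>\<^sub>F F_scale (of_int D) F_one + F_sqrt \<otimes>\<^sub>F F_sqrt"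
    by (simp add: swap_tensor_add tens_balanced)
  from ann[OF this casimir_in_\<Lambda>\<^sub>1(1)] have "of_int D * b F_one F_one + b F_sqrt F_sqrt = 0"
    unfolding tensor_pairing_add_right tensor_pairing_scale_right b_def .
  then have ss: "b F_sqrt F_sqrt = - of_int D * b F_one F_one"
    by linarith
  have "swap_tensor (F_one \<otimes>\<^sub>F F_sqrt + F_sqrt \<otimes>\<^sub>F F_one)
      = F_one \<otimes>\<^sub>F F_sqrt + F_sqrt \<otimes>\<^sub>F F_one"
    by (simp add: swap_tensor_add add.commute)
  from ann[OF this casimir_in_\<Lambda>\<^sub>1(2)] have "b F_one F_sqrt + b F_sqrt F_one = 0"
    unfolding tensor_pairing_add_right b_def .
  then have os: "b F_sqrt F_one = - b F_one F_sqrt"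
    by linarith
  have ii: "b F_idem F_idem = 0"
    using ann[OF swap_tensor_tens casimir_in_\<Lambda>\<^sub>1(3)] by (simp add: b_def)
  \<comment> \<open>As an element of the symmetric square, \<open>a\<close> only determines the sums \<open>b x y + b y x\<close>.\<close>
  define v :: "rat ^ 3" where "v = vector
     [- b F_one F_one / of_int D, (b F_one F_idem + b F_idem F_one) / 2,
      (b F_sqrt F_idem + b F_idem F_sqrt) / (2 * of_int D)]"
  show ?thesis
  proof (intro exI allI)
    fix w :: F
    obtain x y q where w: "w = ((x, y), q)"
      by (metis surj_pair)
    have expansion: "w = F_scale x F_one + (F_scale y F_sqrt + F_scale q F_idem)"
      unfolding w by (rule F_basis_expansion)
    have "pairing D a (square_tensor w) = b w w"
      by (simp add: s pairing_abs square_tensor.rep_eq b_def)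
    also have "\<dots> = x\<^sup>2 * b F_one F_one - of_int D * y\<^sup>2 * b F_one F_one
        + x * q * (b F_one F_idem + b F_idem F_one) + y * q * (b F_sqrt F_idem + b F_idem F_sqrt)"
      unfolding expansion b_add b_scale ss os ii
      by (simp add: power2_eq_square algebra_simps)
    also have "\<dots> = x\<^sup>2 * (- (of_int D * v $ 1)) - of_int D * y\<^sup>2 * (- (of_int D * v $ 1))
        + x * q * (2 * v $ 2) + y * q * (2 * of_int D * v $ 3)"
      using \<open>D \<noteq> 0\<close> by (simp add: v_def)
    also have "\<dots> = scalar_product v (Q D w)"
      by (simp add: scalar_product_Q w power2_eq_square algebra_simps)
    finally show "pairing D a (square_tensor w) = scalar_product v (Q D w)" .
  qed
qed

text \<open>
  Multiplications are self-adjoint for the trace form. Hence a tensor \<open>t\<close> in \<open>\<Lambda>\<^sub>1\<close> allows factors to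
  be moved from \<open>x\<close> to \<open>y\<close>, and its pairing with \<open>x \<otimes> y\<close> depends on the product \<open>x y\<close> only.
\<close>

lemma tensor_pairing_\<Lambda>\<^sub>1:
  assumes "t \<in> \<Lambda>\<^sub>1 D"
  shows "tensor_pairing D (x \<otimes>\<^sub>F y) t = tensor_pairing D (((1, 0), 1) \<otimes>\<^sub>F F_mult D x y) t"
proof -
  let ?u = "((1, 0), 1) :: F"
  have "F_mult D x ?u = x"
    by (simp add: F_mult_def K_mult_def)
  then have "tensor_pairing D (x \<otimes>\<^sub>F y) t = tensor_pairing D (left_mult D x (?u \<otimes>\<^sub>F y)) t"
    by simp
  also have "\<dots> = tensor_pairing D (?u \<otimes>\<^sub>F y) (right_mult D t x)"
    using assms unfolding \<Lambda>\<^sub>1_def by (simp only: mem_Collect_eq tensor_pairing_left_mult[symmetric])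
  also have "\<dots> = tensor_pairing D (?u \<otimes>\<^sub>F F_mult D x y) t"
    by (simp add: tensor_pairing_right_mult F_mult_commute)
  finally show ?thesis .
qed

text \<open>
  Since the pairing of \<open>\<Sum> x\<^sub>i \<otimes> y\<^sub>i\<close> with \<open>\<Lambda>\<^sub>1\<close> is a function of \<open>\<Sum> x\<^sub>i y\<^sub>i\<close>, it suffices to write the
  quadratic form as \<open>\<Sum> tr\<^sub>p (x\<^sub>i w) tr\<^sub>p (y\<^sub>i w)\<close> with \<open>\<Sum> x\<^sub>i y\<^sub>i = 0\<close>.
\<close>

lemma Ann_\<Lambda>\<^sub>1_realizes_scalar_product:
  assumes "D \<noteq> 0"
  shows "\<exists>a\<in>Ann D (\<Lambda>\<^sub>1 D). \<forall>w. pairing D a (square_tensor w) = scalar_product v (Q D w)"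
proof -
  \<comment> \<open>\<open>X\<close>, \<open>Y\<close> and \<open>F_idem\<close> represent the coordinates of \<open>F\<close> through the trace form.\<close>
  define X :: F where "X = ((1 / 2, 0), 0)"
  define Y :: F where "Y = ((0, 1 / (2 * of_int D)), 0)"
  define s where "s = F_scale (- of_int D * v $ 1) X \<otimes>\<^sub>F X
      + (F_scale ((of_int D)\<^sup>2 * v $ 1) Y \<otimes>\<^sub>F Y
      + (F_scale (2 * v $ 2) X \<otimes>\<^sub>F F_idem + F_scale (2 * of_int D * v $ 3) Y \<otimes>\<^sub>F F_idem))"
  have products: "F_mult D (F_scale (- of_int D * v $ 1) X) X
      + (F_mult D (F_scale ((of_int D)\<^sup>2 * v $ 1) Y) Y
      + (F_mult D (F_scale (2 * v $ 2) X) F_idem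
      + F_mult D (F_scale (2 * of_int D * v $ 3) Y) F_idem)) = 0"
    using assms
    by (simp add: X_def Y_def F_idem_def F_mult_def K_mult_def F_scale_def zero_prod_def
        power2_eq_square field_simps)
  have "tensor_pairing D s t = 0" if t: "t \<in> \<Lambda>\<^sub>1 D" for t
  proof -
    have "tensor_pairing D s t = tensor_pairing D (((1, 0), 1) \<otimes>\<^sub>F 0) t"
      unfolding products[symmetric] s_def tens_add_right tensor_pairing_add_left
      by (simp only: tensor_pairing_\<Lambda>\<^sub>1[OF t, of "F_scale c x" for c x])
    also have "\<dots> = 0"
      using tens_add_right[of "((1, 0), 1)" 0 0] tensor_pairing_diff_left[of D 0 0 t] by simp
    finally show ?thesis .
  qed
  then have "abs_sym_quotient s \<in> Ann D (\<Lambda>\<^sub>1 D)"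
    by (simp add: Ann_def pairing_abs)
  moreover have "pairing D (abs_sym_quotient s) (square_tensor w) = scalar_product v (Q D w)" for w
  proof -
    obtain x y q where w: "w = ((x, y), q)"
      by (metis surj_pair)
    have coords: "tr\<^sub>p (F_mult D X w) = x" "tr\<^sub>p (F_mult D Y w) = y" "tr\<^sub>p (F_mult D F_idem w) = q"
      using assms by (simp_all add: w X_def Y_def F_idem_def F_mult_def K_mult_def tr\<^sub>p_def
          K_trace_def K_conj_def)
    have "pairing D (abs_sym_quotient s) (square_tensor w)
        = - of_int D * v $ 1 * x\<^sup>2 + (of_int D)\<^sup>2 * v $ 1 * y\<^sup>2 + 2 * v $ 2 * x * q
          + 2 * of_int D * v $ 3 * y * q"
      by (simp add: pairing_abs square_tensor.rep_eq s_def tensor_pairing_add_left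
          tensor_pairing_tens F_mult_scale_left tr\<^sub>p_scale coords power2_eq_square)
    also have "\<dots> = scalar_product v (Q D w)"
      by (simp add: scalar_product_Q w power2_eq_square algebra_simps)
    finally show ?thesis .
  qed
  ultimately show ?thesis
    by blast
qed

lemma admissible_iff_scalar_product:
  assumes "D \<noteq> 0"
  shows "admissible D S \<longleftrightarrow>
    (\<forall>v. (\<forall>w\<in>Weight S. 0 \<le> scalar_product v (Q D w)) \<longrightarrow>
         (\<forall>w\<in>Weight S. scalar_product v (Q D w) = 0))"
proof (intro iffI allI impI)
  fix v
  assume "admissible D S" and v: "\<forall>w\<in>Weight S. 0 \<le> scalar_product v (Q D w)"
  moreover obtain a where a: "a \<in> Ann D (\<Lambda>\<^sub>1 D)"
    "\<forall>w. pairing D a (square_tensor w) = scalar_product v (Q D w)"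
    using Ann_\<Lambda>\<^sub>1_realizes_scalar_product[OF assms, of v] by blast
  ultimately have "a \<in> cone D S \<inter> Ann D (\<Lambda>\<^sub>1 D)"
    by (simp add: cone_def del: split_paired_All)
  then have "a \<in> null_space D S"
    using \<open>admissible D S\<close> unfolding admissible_def by blast
  then show "\<forall>w\<in>Weight S. scalar_product v (Q D w) = 0"
    by (simp add: null_space_def a(2))
next
  assume *: "\<forall>v. (\<forall>w\<in>Weight S. 0 \<le> scalar_product v (Q D w)) \<longrightarrow>
         (\<forall>w\<in>Weight S. scalar_product v (Q D w) = 0)"
  show "admissible D S"
    unfolding admissible_def
  proof
    fix a
    assume a: "a \<in> cone D S \<inter> Ann D (\<Lambda>\<^sub>1 D)"
    obtain v where v: "\<forall>w. pairing D a (square_tensor w) = scalar_product v (Q D w)"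
      using pairing_Ann_\<Lambda>\<^sub>1_eq_scalar_product[OF assms IntD2[OF a]] by blast
    have "\<forall>w\<in>Weight S. 0 \<le> scalar_product v (Q D w)"
      using a by (simp add: cone_def v)
    then have "\<forall>w\<in>Weight S. scalar_product v (Q D w) = 0"
      using * by blast
    then show "a \<in> null_space D S"
      by (simp add: null_space_def v)
  qed
qed


section \<open>Weights of a stratum\<close>

text \<open>
  All curves in a stratum have the same weights, because a homeomorphism that maps nodes onto nodes
  maps cusps onto cusps.
\<close>

lemma Weight_eq_weight_image:
  assumes "S \<in> boundary_strata I"
  obtains X where "weighted_stable_curve I X" and "Weight S = weight X ` cusps X"
proof -
  obtain X where X: "weighted_stable_curve I X"
    and S: "S = {Y. weighted_stable_curve I Y \<and> weighted_homeomorphic X Y}"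
    using assms by (auto simp: boundary_strata_def quotient_def)
  have "weight Y ` cusps Y = weight X ` cusps X" if Y: "Y \<in> S" for Y
  proof -
    obtain f where f: "(`) f ` nodes X = nodes Y" "\<forall>c\<in>cusps X. weight Y (f c) = weight X c"
      using Y unfolding S weighted_homeomorphic_def by blast
    have "cusps Y = f ` cusps X"
      by (auto simp: cusps_def simp flip: f(1))
    then show ?thesis
      using f(2) by (auto simp: image_iff)
  qed
  moreover have "X \<in> S"
    using X by (auto simp: S weighted_homeomorphic_def intro!: exI[of _ id])
  ultimately have "Weight S = weight X ` cusps X"
    unfolding Weight_def by blast
  then show ?thesis
    using X that by blast
qed

lemma Weight_finite_nonempty:
  assumes "S \<in> boundary_strata I"
  shows "finite (Weight S)" and "Weight S \<noteq> {}"
proof -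
  obtain X where X: "weighted_stable_curve I X" and W: "Weight S = weight X ` cusps X"
    using Weight_eq_weight_image[OF assms] by blast
  \<comment> \<open>There are cusps because stability gives at least three of them to each component.\<close>
  have nodal: "nodal_curve X" and three: "\<forall>i\<in>components X. 3 \<le> card {c \<in> cusps X. fst c = i}"
    using X by (auto simp: weighted_stable_curve_def stable_curve_def)
  have "\<forall>n\<in>nodes X. finite n"
    using nodal by (metis card.infinite nodal_curve_def zero_neq_numeral)
  then show "finite (Weight S)"
    using nodal by (auto simp: W cusps_def nodal_curve_def)
  obtain i where "i \<in> components X"
    using nodal by (auto simp: nodal_curve_def)
  then have "{c \<in> cusps X. fst c = i} \<noteq> {}"
    using three by (metis card.empty not_numeral_le_zero)
  then show "Weight S \<noteq> {}"
    by (auto simp: W)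
qed


section \<open>Farkas' lemma over ordered fields\<close>

lemma scalar_product_add_right: "scalar_product v (x + y) = scalar_product v x + scalar_product v y"
  by (simp add: scalar_product_def distrib_left sum.distrib)

lemma scalar_product_scale_right:
  fixes v :: "'a::comm_ring_1 ^ 'n"
  shows "scalar_product v (c *s x) = c * scalar_product v x"
  by (simp add: scalar_product_def sum_distrib_left mult.left_commute)

lemma scalar_product_commute:
  fixes v :: "'a::comm_ring_1 ^ 'n"
  shows "scalar_product v x = scalar_product x v"
  by (simp add: scalar_product_def mult.commute)

lemma scalar_product_sum_right:
  fixes v :: "'a::comm_ring_1 ^ 'n"
  shows "scalar_product v (\<Sum>i\<in>J. c i *s x i) = (\<Sum>i\<in>J. c i * scalar_product v (x i))"
  by (induction J rule: infinite_finite_induct)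
    (simp_all add: scalar_product_add_right scalar_product_scale_right, simp_all add: scalar_product_def)

lemma scalar_product_diff_scale_right:
  fixes v :: "'a::comm_ring_1 ^ 'n"
  shows "scalar_product v (x - c *s y) = scalar_product v x - c * scalar_product v y"
  using scalar_product_add_right[of v "x - c *s y" "c *s y"]
  by (simp add: scalar_product_scale_right)

lemma scalar_product_diff_scale_left:
  fixes v :: "'a::comm_ring_1 ^ 'n"
  shows "scalar_product (x - c *s y) v = scalar_product x v - c * scalar_product y v"
  by (metis scalar_product_commute scalar_product_diff_scale_right)

lemma scalar_product_axis: "scalar_product v (axis i 1) = v $ i"
  by (simp add: scalar_product_def axis_def if_distrib cong: if_cong)

text \<open>
  Separation by compactness fails over a general ordered field such as \<open>\<rat>\<close>. The proof is therefore
  algebraic, by induction on the number of generators. If the last generator \<open>a k\<close> is needed, then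
  some \<open>z\<close> is non-negative on the others and negative on \<open>b\<close>, hence negative on \<open>a k\<close>. Projecting
  along \<open>z\<close> onto the hyperplane orthogonal to \<open>a k\<close> removes \<open>a k\<close> from the problem, and the signs
  of \<open>z\<close> make the coefficient of \<open>a k\<close> non-negative in the end. The generators are a family rather
  than a set, since their projections may coincide.
\<close>

lemma farkas:
  fixes a :: "'i \<Rightarrow> 'a::linordered_field ^ 'n" and b :: "'a ^ 'n"
  assumes "finite J"
    and "\<And>x. (\<And>i. i \<in> J \<Longrightarrow> 0 \<le> scalar_product x (a i)) \<Longrightarrow> 0 \<le> scalar_product x b"
  shows "\<exists>u. (\<forall>i\<in>J. 0 \<le> u i) \<and> b = (\<Sum>i\<in>J. u i *s a i)"
  using assms
proof (induction J arbitrary: a b rule: finite_induct)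
  case empty
  have "b $ i = 0" for i
    using empty[of "axis i 1"] empty[of "- axis i 1"]
      scalar_product_diff_scale_right[of b 0 1 "axis i 1"]
    by (simp add: scalar_product_axis scalar_product_commute[of _ b]) (simp add: scalar_product_def)
  then show ?case
    by (simp add: vec_eq_iff)
next
  case (insert k J)
  show ?case
  proof (cases "\<forall>x. (\<forall>i\<in>J. 0 \<le> scalar_product x (a i)) \<longrightarrow> 0 \<le> scalar_product x b")
    case True
    then obtain u where u: "\<forall>i\<in>J. 0 \<le> u i" "b = (\<Sum>i\<in>J. u i *s a i)"
      using insert.IH[of a b] by blast
    have "(\<Sum>i\<in>insert k J. (u(k := 0)) i *s a i) = (\<Sum>i\<in>J. u i *s a i)"
      using insert.hyps by (auto intro: sum.cong)
    then show ?thesis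
      using u by (intro exI[of _ "u(k := 0)"]) auto
  next
    case False
    then obtain z where zJ: "\<forall>i\<in>J. 0 \<le> scalar_product z (a i)" and zb: "scalar_product z b < 0"
      by (auto simp: not_le)
    have zk: "scalar_product z (a k) < 0"
    proof (rule ccontr)
      assume "\<not> scalar_product z (a k) < 0"
      then have "0 \<le> scalar_product z b"
        using zJ by (intro insert.prems) auto
      then show False
        using zb by simp
    qed
    define r where "r c = scalar_product z c / scalar_product z (a k)" for c
    define p where "p c = c - r c *s a k" for c
    \<comment> \<open>\<open>p\<close> is the adjoint of the projection along \<open>z\<close> onto the hyperplane orthogonal to \<open>a k\<close>.\<close>
    have adj: "scalar_product x (p c) =
        scalar_product (x - (scalar_product x (a k) / scalar_product z (a k)) *s z) c" for x c
      by (simp add: p_def r_def scalar_product_diff_scale_right scalar_product_diff_scale_left)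
    have "0 \<le> scalar_product x (p b)" if x: "\<And>i. i \<in> J \<Longrightarrow> 0 \<le> scalar_product x (p (a i))" for x
    proof -
      let ?y = "x - (scalar_product x (a k) / scalar_product z (a k)) *s z"
      have "scalar_product ?y (a k) = 0"
        using zk by (simp add: scalar_product_diff_scale_left)
      then show ?thesis
        using insert.prems[of ?y] x unfolding adj by force
    qed
    then obtain u where u: "\<forall>i\<in>J. 0 \<le> u i" and pb: "p b = (\<Sum>i\<in>J. u i *s p (a i))"
      using insert.IH[of "\<lambda>i. p (a i)" "p b"] by blast
    define s where "s = r b - (\<Sum>i\<in>J. u i * r (a i))"
    have "r (a i) \<le> 0" if "i \<in> J" for i
      using zJ zk that by (simp add: r_def divide_nonneg_neg)
    then have "(\<Sum>i\<in>J. u i * r (a i)) \<le> 0"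
      using u by (intro sum_nonpos) (simp add: mult_nonneg_nonpos)
    moreover have "0 \<le> r b"
      using zb zk by (simp add: r_def divide_nonpos_neg)
    ultimately have s: "0 \<le> s"
      by (simp add: s_def)
    have "b = (\<Sum>i\<in>J. u i *s a i) + s *s a k"
      using pb
      by (simp add: p_def s_def vec_eq_iff algebra_simps sum_subtractf sum_distrib_left)
    moreover have "(\<Sum>i\<in>insert k J. (u(k := s)) i *s a i) = s *s a k + (\<Sum>i\<in>J. u i *s a i)"
      using insert.hyps by (auto intro!: sum.cong)
    ultimately show ?thesis
      using u s by (intro exI[of _ "u(k := s)"]) (auto simp: add.commute)
  qed
qed


section \<open>Half-spaces of the span\<close>

lemma projection_onto_subspace:
  fixes V :: "('a::field ^ 'n) set"
  assumes "vec.subspace V"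
  obtains P where "Vector_Spaces.linear (*s) (*s) P" and "\<And>x. P x \<in> V" and "\<And>x. x \<in> V \<Longrightarrow> P x = x"
proof -
  have "\<exists>P. range P \<subseteq> V \<and> Vector_Spaces.linear (*s) (*s) P \<and> (\<forall>x\<in>V. P (id x) = x)"
    using assms by (intro vec.linear_exists_left_inverse_on vec.linear_id) auto
  then show ?thesis
    using that by (auto simp: image_subset_iff)
qed

lemma linear_image_basis_expansion:
  fixes x :: "'a::field ^ 'n"
  assumes "Vector_Spaces.linear (*s) (*s) P"
  shows "P x = (\<Sum>i\<in>UNIV. x $ i *s P (axis i 1))"
proof -
  interpret Vector_Spaces.linear "(*s)" "(*s)" P by fact
  have "P x = P (\<Sum>i\<in>UNIV. x $ i *s axis i 1)"
    by (simp add: basis_expansion)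
  then show ?thesis
    by (simp only: sum scale)
qed

text \<open>
  A linear form on a subspace extends to the whole space along a projection.
\<close>

lemma linear_form_on_scalar_product:
  fixes V :: "(rat ^ 'n) set"
  assumes V: "vec.subspace V" and l: "linear_form_on V l"
  obtains v where "\<And>x. x \<in> V \<Longrightarrow> l x = scalar_product v x"
proof -
  obtain P where P: "Vector_Spaces.linear (*s) (*s) P" "\<And>x. P x \<in> V" "\<And>x. x \<in> V \<Longrightarrow> P x = x"
    using projection_onto_subspace[OF V] by metis
  have l0: "l 0 = 0"
    using l vec.subspace_0[OF V] unfolding linear_form_on_def
    by (metis mult_zero_left vector_smult_lzero)
  have sum: "l (\<Sum>i\<in>J. c i *s P (axis i 1)) = (\<Sum>i\<in>J. c i * l (P (axis i 1)))"
    if "finite J" for J :: "'n set" and c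
    using that
  proof induction
    case (insert k J)
    have "(\<Sum>i\<in>J. c i *s P (axis i 1)) \<in> V"
      by (intro vec.subspace_sum vec.subspace_scale V P(2))
    moreover have "c k *s P (axis k 1) \<in> V"
      by (intro vec.subspace_scale V P(2))
    ultimately show ?case
      using insert l P(2) by (simp add: linear_form_on_def)
  qed (simp add: l0)
  show ?thesis
  proof
    fix x assume "x \<in> V"
    then have "l x = l (P x)"
      by (simp add: P(3))
    also have "\<dots> = l (\<Sum>i\<in>UNIV. x $ i *s P (axis i 1))"
      by (subst linear_image_basis_expansion[OF P(1)]) (rule refl)
    also have "\<dots> = scalar_product (\<chi> i. l (P (axis i 1))) x"
      by (simp add: sum scalar_product_def mult.commute)
    finally show "l x = scalar_product (\<chi> i. l (P (axis i 1))) x" .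
  qed
qed

text \<open>
  \<open>A\<close> is one-sided if it lies in a half-space of the ambient space whose bounding hyperplane does not
  contain \<open>A\<close>. This avoids the span of \<open>A\<close>; by the next lemma it is the same as lying in a
  half-space of the span.
\<close>

definition one_sided :: "('a::linordered_field ^ 'n) set \<Rightarrow> bool" where
  "one_sided A \<longleftrightarrow>
     (\<exists>v. (\<forall>a\<in>A. 0 \<le> scalar_product v a) \<and> (\<exists>a\<in>A. scalar_product v a \<noteq> 0))"

lemma subset_closed_half_space_iff_one_sided:
  fixes A :: "(rat ^ 'n) set"
  shows "(\<exists>H. closed_half_space (vec.span A) H \<and> A \<subseteq> H) \<longleftrightarrow> one_sided A"
proof
  assume "\<exists>H. closed_half_space (vec.span A) H \<and> A \<subseteq> H"
  then obtain l x where l: "linear_form_on (vec.span A) l"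
    and x: "x \<in> vec.span A" "l x \<noteq> 0" and A: "\<forall>a\<in>A. 0 \<le> l a"
    unfolding closed_half_space_def by blast
  obtain v where v: "\<And>y. y \<in> vec.span A \<Longrightarrow> l y = scalar_product v y"
    using linear_form_on_scalar_product[OF vec.subspace_span l] by blast
  have "\<exists>a\<in>A. scalar_product v a \<noteq> 0"
  proof (rule ccontr)
    assume *: "\<not> (\<exists>a\<in>A. scalar_product v a \<noteq> 0)"
    have "scalar_product v x = 0"
      using x(1)
    proof (induction rule: vec.span_induct_alt)
      case base
      show ?case by (simp add: scalar_product_def)
    next
      case (step c a y)
      then show ?case
        using * by (simp add: scalar_product_add_right scalar_product_scale_right)
    qed
    then show False
      using x v by simp
  qed
  then show "one_sided A"
    using A v vec.span_base unfolding one_sided_def by metis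
next
  assume "one_sided A"
  then obtain v a where v: "\<forall>a\<in>A. 0 \<le> scalar_product v a" "a \<in> A" "scalar_product v a \<noteq> 0"
    by (auto simp: one_sided_def)
  have "linear_form_on (vec.span A) (scalar_product v)"
    by (simp add: linear_form_on_def scalar_product_add_right scalar_product_scale_right)
  then have "closed_half_space (vec.span A) {x \<in> vec.span A. 0 \<le> scalar_product v x}"
    unfolding closed_half_space_def using v vec.span_base by metis
  then show "\<exists>H. closed_half_space (vec.span A) H \<and> A \<subseteq> H"
    using v(1) vec.span_base by (intro exI conjI) auto
qed


section \<open>The interior of the convex hull\<close>

text \<open>
  A functional that is non-negative on \<open>A\<close> vanishes on \<open>A\<close>, hence is non-negative also on
  \<open>- a\<close> for \<open>a\<close> in \<open>A\<close>. So Farkas' lemma puts \<open>- a\<close> into the cone over \<open>A\<close>, which is therefore a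
  subspace.
\<close>

lemma not_one_sided_span_cone:
  fixes A :: "('a::linordered_field ^ 'n) set"
  assumes A: "finite A" and "\<not> one_sided A" and "x \<in> vec.span A"
  shows "\<exists>u. (\<forall>a\<in>A. 0 \<le> u a) \<and> x = (\<Sum>a\<in>A. u a *s a)"
  using \<open>x \<in> vec.span A\<close>
proof (induction rule: vec.span_induct_alt)
  case base
  show ?case
    by (intro exI[of _ "\<lambda>_. 0"]) simp
next
  case (step c a y)
  then obtain u where u: "\<forall>a\<in>A. 0 \<le> u a" "y = (\<Sum>a\<in>A. u a *s a)"
    by blast
  have "0 \<le> scalar_product v (c *s a)" if "\<And>b. b \<in> A \<Longrightarrow> 0 \<le> scalar_product v b" for v
    using that assms(2) \<open>a \<in> A\<close> unfolding one_sided_def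
    by (metis order_refl mult_zero_right scalar_product_scale_right)
  then obtain w where w: "\<forall>b\<in>A. 0 \<le> w b" "c *s a = (\<Sum>b\<in>A. w b *s b)"
    using farkas[OF A, of "\<lambda>b. b" "c *s a"] by auto
  show ?case
    using u w
    by (intro exI[of _ "\<lambda>a. w a + u a"]) (simp add: vector_sadd_rdistrib sum.distrib)
qed

text \<open>
  For finite \<open>A\<close> the coefficients can be indexed by all of \<open>A\<close>, so that combinations are added
  by adding their coefficients.
\<close>

lemma rat_convex_hull_finite:
  assumes "finite A"
  shows "rat_convex_hull A = {\<Sum>a\<in>A. u a *s a | u. (\<forall>a\<in>A. 0 \<le> u a) \<and> sum u A = 1}"
proof safe
  fix x assume "x \<in> rat_convex_hull A"
  then obtain t u where t: "x = (\<Sum>a\<in>t. u a *s a)" "finite t" "t \<subseteq> A" "\<forall>a\<in>t. 0 \<le> u a" "sum u t = 1"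
    by (auto simp: rat_convex_hull_def)
  let ?u = "\<lambda>a. if a \<in> t then u a else 0"
  have "x = (\<Sum>a\<in>A. ?u a *s a)" "sum ?u A = 1"
    using t assms by (auto simp: if_distrib[of "\<lambda>c. c *s _"] sum.If_cases Int_absorb1 cong: if_cong)
  then show "\<exists>u. x = (\<Sum>a\<in>A. u a *s a) \<and> (\<forall>a\<in>A. 0 \<le> u a) \<and> sum u A = 1"
    using t(4) by (intro exI[of _ ?u]) auto
next
  fix u :: "rat ^ 'a \<Rightarrow> rat"
  assume "\<forall>a\<in>A. 0 \<le> u a" "sum u A = 1"
  then show "(\<Sum>a\<in>A. u a *s a) \<in> rat_convex_hull A"
    using assms unfolding rat_convex_hull_def by blast
qed

text \<open>
  The missing coefficient mass is filled up by a convex combination that represents \<open>0\<close>.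
\<close>

lemma sub_convex_combination_in_rat_convex_hull:
  assumes A: "finite A" and z: "0 \<in> rat_convex_hull A"
    and u: "\<forall>a\<in>A. 0 \<le> u a" "sum u A \<le> 1"
  shows "(\<Sum>a\<in>A. u a *s a) \<in> rat_convex_hull A"
proof -
  obtain z where z: "0 = (\<Sum>a\<in>A. z a *s a)" "\<forall>a\<in>A. 0 \<le> z a" "sum z A = 1"
    using z unfolding rat_convex_hull_finite[OF A] by blast
  let ?u = "\<lambda>a. u a + (1 - sum u A) * z a"
  have "(\<Sum>a\<in>A. ?u a *s a) = (\<Sum>a\<in>A. u a *s a) + (1 - sum u A) *s (\<Sum>a\<in>A. z a *s a)"
    by (simp add: vector_sadd_rdistrib sum.distrib vec.scale_sum_right)
  then have "(\<Sum>a\<in>A. u a *s a) = (\<Sum>a\<in>A. ?u a *s a)"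
    using z(1) by simp
  moreover have "sum ?u A = 1"
    using z(3) by (simp add: sum.distrib flip: sum_distrib_left)
  moreover have "\<forall>a\<in>A. 0 \<le> ?u a"
    using u z(2) by simp
  ultimately show ?thesis
    unfolding rat_convex_hull_finite[OF A] mem_Collect_eq by (intro exI[of _ ?u] conjI)
qed

text \<open>
  If \<open>b\<close> is in \<open>A\<close>, then \<open>- b\<close> is in the cone over \<open>A\<close>. This writes \<open>0 = b + (- b)\<close> with
  non-negative coefficients whose sum is at least \<open>1\<close>; it remains to divide by the sum.
\<close>

lemma zero_in_rat_convex_hull:
  assumes A: "finite A" "A \<noteq> {}" and "\<not> one_sided A"
  shows "0 \<in> rat_convex_hull A"
proof -
  obtain b where b: "b \<in> A"
    using A by blast
  then have "- b \<in> vec.span A"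
    by (simp add: vec.span_base vec.span_neg)
  then obtain u where u: "\<forall>a\<in>A. 0 \<le> u a" "- b = (\<Sum>a\<in>A. u a *s a)"
    using not_one_sided_span_cone assms by blast
  let ?s = "1 + sum u A"
  let ?u = "\<lambda>a. ((if a = b then 1 else 0) + u a) / ?s"
  have s: "?s > 0"
    using u(1) by (simp add: add_pos_nonneg sum_nonneg)
  have "(\<Sum>a\<in>A. ?u a *s a) = (1 / ?s) *s (\<Sum>a\<in>A. ((if a = b then 1 else 0) + u a) *s a)"
    by (simp add: vec.scale_sum_right add_divide_distrib vector_sadd_rdistrib)
  also have "(\<Sum>a\<in>A. ((if a = b then 1 else 0) + u a) *s a) = b + (\<Sum>a\<in>A. u a *s a)"
    using A b by (simp add: vector_sadd_rdistrib sum.distrib if_distrib[of "\<lambda>c. c *s _"] cong: if_cong)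
  finally have "0 = (\<Sum>a\<in>A. ?u a *s a)"
    using u(2) by (metis add.right_inverse vector_ssub_ldistrib vec.scale_zero_right)
  moreover have "sum ?u A = 1"
    using A b s by (simp add: sum.distrib flip: sum_divide_distrib)
  moreover have "\<forall>a\<in>A. 0 \<le> ?u a"
    using u(1) s by simp
  ultimately show ?thesis
    unfolding rat_convex_hull_finite[OF A(1)] mem_Collect_eq by (intro exI[of _ ?u] conjI)
qed

lemma openin_rat_topology_cube:
  fixes d :: rat
  shows "openin rat_topology {x :: rat ^ 'n. \<forall>i. \<bar>x $ i\<bar> < d}"
proof -
  have "open {y :: real ^ 'n. \<forall>i. \<bar>y $ i\<bar> < of_rat d}"
    unfolding Collect_all_eq
    by (intro open_INT ballI finite_class.finite_UNIV open_Collect_less continuous_intros)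
  moreover have "{x :: rat ^ 'n. \<forall>i. \<bar>x $ i\<bar> < d} =
      (\<lambda>v. (\<chi> i. of_rat (v $ i)) :: real ^ 'n) -` {y. \<forall>i. \<bar>y $ i\<bar> < of_rat d} \<inter> UNIV"
    by (auto simp: of_rat_less abs_less_iff simp flip: of_rat_minus)
  ultimately show ?thesis
    unfolding rat_topology_def openin_pullback_topology by auto
qed

lemma rat_neighbourhood_of_zero_absorbing:
  fixes x :: "rat ^ 'n"
  assumes "openin rat_topology T" and "0 \<in> T"
  obtains e where "e > 0" and "e *s x \<in> T"
proof -
  let ?h = "\<lambda>v. (\<chi> i. of_rat (v $ i)) :: real ^ 'n"
  obtain U where U: "open U" "T = ?h -` U"
    using assms(1) by (auto simp: rat_topology_def openin_pullback_topology)
  have "(\<lambda>n. (1 / real (Suc n)) *\<^sub>R ?h x) \<longlonglongrightarrow> 0 *\<^sub>R ?h x"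
    by (intro tendsto_intros LIMSEQ_Suc[OF lim_1_over_n])
  moreover have "0 \<in> U"
    using assms(2) U(2) by (simp add: zero_vec_def)
  ultimately have "eventually (\<lambda>n. (1 / real (Suc n)) *\<^sub>R ?h x \<in> U) sequentially"
    using U(1) by (simp add: topological_tendstoD)
  then obtain n where "(1 / real (Suc n)) *\<^sub>R ?h x \<in> U"
    using eventually_happens by fastforce
  moreover have "?h ((1 / of_nat (Suc n)) *s x) = (1 / real (Suc n)) *\<^sub>R ?h x"
    by (simp add: vec_eq_iff of_rat_mult of_rat_divide of_rat_add)
  ultimately show ?thesis
    using that[of "1 / of_nat (Suc n)"] U(2) by simp
qed

text \<open>
  If \<open>0\<close> is interior and \<open>v\<close> is non-negative on \<open>A\<close>, then a small multiple of \<open>- b\<close> is in the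
  convex hull for each \<open>b\<close> in \<open>A\<close>, so \<open>v\<close> vanishes at \<open>b\<close>. Conversely, if the cone over \<open>A\<close> is
  the whole span, then a projection \<open>P\<close> onto the span gives \<open>x = \<Sum> x\<^sub>i P e\<^sub>i\<close> for \<open>x\<close> in the span,
  where each of the finitely many vectors \<open>\<plusminus> P e\<^sub>i\<close> is a non-negative combination of \<open>A\<close>. For small
  coordinates \<open>x\<^sub>i\<close> the resulting coefficients of \<open>x\<close> add up to at most \<open>1\<close>.
\<close>

lemma zero_interior_rat_convex_hull_iff:
  fixes A :: "(rat ^ 'n) set"
  assumes A: "finite A" "A \<noteq> {}"
  shows "0 \<in> subtopology rat_topology (vec.span A) interior_of rat_convex_hull A \<longleftrightarrow> \<not> one_sided A"
proof
  assume "0 \<in> subtopology rat_topology (vec.span A) interior_of rat_convex_hull A"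
  then obtain T where T: "openin rat_topology T" "0 \<in> T" "T \<inter> vec.span A \<subseteq> rat_convex_hull A"
    by (auto simp: interior_of_def openin_subtopology)
  show "\<not> one_sided A"
  proof
    assume "one_sided A"
    then obtain v b where v: "\<forall>a\<in>A. 0 \<le> scalar_product v a" and b: "b \<in> A" "scalar_product v b \<noteq> 0"
      by (auto simp: one_sided_def)
    obtain e where e: "e > 0" "e *s (- b) \<in> T"
      using rat_neighbourhood_of_zero_absorbing[OF T(1,2)] by blast
    have "e *s (- b) \<in> vec.span A"
      by (intro vec.span_scale vec.span_neg vec.span_base b(1))
    then have "e *s (- b) \<in> rat_convex_hull A"
      using T(3) e by blast
    then obtain u where u: "e *s (- b) = (\<Sum>a\<in>A. u a *s a)" "\<forall>a\<in>A. 0 \<le> u a"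
      unfolding rat_convex_hull_finite[OF A(1)] by blast
    have "scalar_product v (e *s (- b)) \<ge> 0"
      unfolding u(1) scalar_product_sum_right using u(2) v by (intro sum_nonneg) simp
    moreover have "scalar_product v (e *s (- b)) = - (e * scalar_product v b)"
      by (simp add: scalar_product_def sum_negf sum_distrib_left mult.left_commute)
    ultimately show False
      using e(1) v b by (simp add: mult_le_0_iff order_antisym)
  qed
next
  assume not_os: "\<not> one_sided A"
  obtain P where P: "Vector_Spaces.linear (*s) (*s) P" "\<And>x. P x \<in> vec.span A"
      "\<And>x. x \<in> vec.span A \<Longrightarrow> P x = x"
    using projection_onto_subspace[OF vec.subspace_span] by metis
  have ex: "\<exists>u. (\<forall>a\<in>A. 0 \<le> u a) \<and> s *s P (axis i 1) = (\<Sum>a\<in>A. u a *s a)" for i and s :: rat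
    by (intro not_one_sided_span_cone A not_os vec.span_scale P(2))
  define u where "u i s = (SOME u. (\<forall>a\<in>A. 0 \<le> u a) \<and> s *s P (axis i 1) = (\<Sum>a\<in>A. u a *s a))" for i s
  have u: "\<And>i s a. a \<in> A \<Longrightarrow> 0 \<le> u i s a"
      "\<And>i s. s *s P (axis i 1) = (\<Sum>a\<in>A. u i s a *s a)"
    using someI_ex[OF ex] unfolding u_def by blast+
  \<comment> \<open>\<open>M\<close> exceeds the sum of all coefficients of the vectors \<open>\<plusminus> P e\<^sub>i\<close>, which do not depend on \<open>x\<close>.\<close>
  define M where "M = (\<Sum>i\<in>UNIV. sum (u i 1) A + sum (u i (- 1)) A) + 1"
  have M: "M > 0"
    unfolding M_def using u(1) by (intro add_nonneg_pos sum_nonneg add_nonneg_nonneg) auto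
  have "x \<in> rat_convex_hull A" if x: "x \<in> vec.span A" "\<forall>i. \<bar>x $ i\<bar> < 1 / M" for x
  proof -
    define c where "c a = (\<Sum>i\<in>UNIV. \<bar>x $ i\<bar> * u i (sgn (x $ i)) a)" for a
    have "x $ i *s P (axis i 1) = (\<Sum>a\<in>A. (\<bar>x $ i\<bar> * u i (sgn (x $ i)) a) *s a)" for i
    proof -
      have "x $ i *s P (axis i 1) = \<bar>x $ i\<bar> *s (sgn (x $ i) *s P (axis i 1))"
        by (simp add: abs_mult_sgn)
      then show ?thesis
        by (simp only: u(2) vec.scale_sum_right vec.scale_scale)
    qed
    then have "P x = (\<Sum>i\<in>UNIV. \<Sum>a\<in>A. (\<bar>x $ i\<bar> * u i (sgn (x $ i)) a) *s a)"
      by (subst linear_image_basis_expansion[OF P(1)]) simp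
    also have "\<dots> = (\<Sum>a\<in>A. c a *s a)"
      by (subst sum.swap) (simp add: c_def vec.scale_sum_left)
    finally have "x = (\<Sum>a\<in>A. c a *s a)"
      using P(3) x(1) by simp
    moreover have "\<forall>a\<in>A. 0 \<le> c a"
      unfolding c_def using u(1) by (intro ballI sum_nonneg) simp
    moreover have "sum c A \<le> 1"
    proof -
      have "sum c A = (\<Sum>i\<in>UNIV. \<bar>x $ i\<bar> * sum (u i (sgn (x $ i))) A)"
        unfolding c_def by (subst sum.swap) (simp add: sum_distrib_left)
      also have "\<dots> \<le> (\<Sum>i\<in>UNIV. 1 / M * (sum (u i 1) A + sum (u i (- 1)) A))"
      proof (rule sum_mono)
        fix i
        have nn: "0 \<le> sum (u i s) A" for s
          using u(1) by (intro sum_nonneg) simp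
        have "\<bar>x $ i\<bar> * sum (u i (sgn (x $ i))) A \<le> \<bar>x $ i\<bar> * (sum (u i 1) A + sum (u i (- 1)) A)"
          using nn by (cases "x $ i" "0 :: rat" rule: linorder_cases) (auto intro!: mult_left_mono)
        also have "\<dots> \<le> 1 / M * (sum (u i 1) A + sum (u i (- 1)) A)"
          using nn x(2) by (intro mult_right_mono) (auto intro: less_imp_le)
        finally show "\<bar>x $ i\<bar> * sum (u i (sgn (x $ i))) A \<le> 1 / M * (sum (u i 1) A + sum (u i (- 1)) A)" .
      qed
      also have "\<dots> = (M - 1) / M"
        unfolding M_def by (simp add: sum_divide_distrib)
      also have "\<dots> \<le> 1"
        using M by simp
      finally show ?thesis .
    qed
    ultimately show ?thesis
      using sub_convex_combination_in_rat_convex_hull[OF A(1) zero_in_rat_convex_hull[OF A not_os], of c]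
      by simp
  qed
  moreover have "openin (subtopology rat_topology (vec.span A)) ({x. \<forall>i. \<bar>x $ i\<bar> < 1 / M} \<inter> vec.span A)"
    by (simp add: openin_subtopology_Int openin_rat_topology_cube)
  moreover have "0 \<in> {x. \<forall>i. \<bar>x $ i\<bar> < 1 / M} \<inter> vec.span A"
    using M by (simp add: vec.span_zero)
  ultimately show "0 \<in> subtopology rat_topology (vec.span A) interior_of rat_convex_hull A"
    unfolding interior_of_def by blast
qed


section \<open>The criterion for admissibility\<close>

theorem theorem8p14:
  fixes D :: int and I :: "F set" and S :: "weighted_curve set"
  assumes "D > 0"
    and "D mod 4 = 0 \<or> D mod 4 = 1"
    and "\<nexists>n. D = n\<^sup>2"
    and "is_lattice I"
    and "S \<in> boundary_strata I"
  shows "(admissible D S \<longleftrightarrow>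
            (\<forall>v. (\<forall>w\<in>Weight S. 0 \<le> scalar_product v (Q D w)) \<longrightarrow>
                 (\<forall>w\<in>Weight S. scalar_product v (Q D w) = 0)))
       \<and> (admissible D S \<longleftrightarrow>
            \<not> (\<exists>H. closed_half_space (vec.span (Q D ` Weight S)) H \<and> Q D ` Weight S \<subseteq> H))
       \<and> (\<not> (\<exists>H. closed_half_space (vec.span (Q D ` Weight S)) H \<and> Q D ` Weight S \<subseteq> H) \<longleftrightarrow>
            0 \<in> subtopology rat_topology (vec.span (Q D ` Weight S))
                  interior_of rat_convex_hull (Q D ` Weight S))"
proof -
  have "D \<noteq> 0"
    using assms(1) by simp
  let ?A = "Q D ` Weight S"
  have adm: "admissible D S \<longleftrightarrow>
      (\<forall>v. (\<forall>w\<in>Weight S. 0 \<le> scalar_product v (Q D w)) \<longrightarrow>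
           (\<forall>w\<in>Weight S. scalar_product v (Q D w) = 0))"
    by (rule admissible_iff_scalar_product[OF \<open>D \<noteq> 0\<close>])
  have one_sided: "one_sided ?A \<longleftrightarrow>
      \<not> (\<forall>v. (\<forall>w\<in>Weight S. 0 \<le> scalar_product v (Q D w)) \<longrightarrow>
             (\<forall>w\<in>Weight S. scalar_product v (Q D w) = 0))"
    unfolding one_sided_def by (simp only: ball_simps bex_simps) blast
  have half_space: "(\<exists>H. closed_half_space (vec.span ?A) H \<and> ?A \<subseteq> H) \<longleftrightarrow> one_sided ?A"
    by (rule subset_closed_half_space_iff_one_sided)
  have interior: "0 \<in> subtopology rat_topology (vec.span ?A) interior_of rat_convex_hull ?A
      \<longleftrightarrow> \<not> one_sided ?A"
    using Weight_finite_nonempty[OF assms(5)]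
    by (intro zero_interior_rat_convex_hull_iff) simp_all
  show ?thesis
    by (simp only: half_space interior one_sided adm not_not simp_thms)
qed

end
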